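(* There exists a two-parameter family of MUB-triplets of order $6$ emerging from the family $X_6(\alpha)$, $\alpha\in\mathbb{D}$, via Zauner's construction. That is: for every $\alpha\in\mathbb{D}$ and every quadruple $(x,y,u,v)$ admissible for $\alpha$, let $T=\frac{1}{\sqrt6}H(x,y,u,v)$, where $H(x,y,u,v)$ is the $2$-circulant matrix defined in the context. Then there exist unitary diagonal $3\times 3$ matrices $U,V,X,Y$ such that the matrices $$Z_1=\frac{1}{\sqrt2}\begin{bmatrix}F_3 & XF_3\\ F_3 & -XF_3\end{bmatrix},\qquad Z_2=\frac{1}{\sqrt2}\begin{bmatrix}UF_3 & UYF_3\\ VF_3 & -VYF_3\end{bmatrix}$$ satisfy $T=Z_1^{-1}Z_2$, and $\{I_6,Z_1,Z_2\}$ is a triplet of mutually unbiased bases of $\mathbb{C}^6$.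
   Context: $\mathbb{T}=\{z\in\mathbb{C}:|z|=1\}$. $F_3$ is the unitary Fourier matrix of order $3$, $F_3=\frac{1}{\sqrt3}\left[e^{2\pi \mathbf{i}jk/3}\right]_{j,k=0}^{2}$. Mutually unbiased bases (MUBs) of $\mathbb{C}^n$: a collection of orthonormal bases $\mathcal{B}_1,\dots,\mathcal{B}_k$ of $\mathbb{C}^n$ such that $|\langle e,f\rangle|=1/\sqrt n$ whenever $e\in\mathcal{B}_i$, $f\in\mathcal{B}_j$, $i\ne j$. A unitary matrix is identified with the orthonormal basis formed by its columns; a MUB-triplet of order $6$ is a collection of three MUBs of $\mathbb{C}^6$. Let $\varphi:\mathbb{T}\times\mathbb{T}\to\mathbb{C}$, $\varphi[x,y]=x+y+\frac{1}{xy}$, and $\mathbb{D}=\mathrm{ran}(\varphi)\cap\mathrm{ran}(-\varphi)\subset\mathbb{C}$, a planar region, so that $\alpha\in\mathbb{D}$ stands for two real parameters. For $\alpha\in\mathbb{C}$ let $f_\alpha(x)=x^3-\alpha x^2+\overline{\alpha}x-1$. For $\alpha\in\mathbb{D}$ let $r_1,r_2,r_3$ be the roots of $f_\alpha$ and $q_1,q_2,q_3$ the roots of $f_{-\alpha}$, both listed with multiplicity. A quadruple $(x,y,u,v)$ is admissible for $\alpha$ if $(x,y)=(r_i,r_j)$ and $(u,v)=(q_k,q_l)$ for some $i\neq j$, $k\neq l$. For an admissible quadruple put $a=d=1$, $b=\overline{x}$, $c=\overline{x}\,\overline{y}$, $e=\overline{u}$, $f=\overline{u}\,\overline{v}$ and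 $$A=\begin{bmatrix} a & b & c \\ c & a & b \\ b & c & a \end{bmatrix},\quad B=\begin{bmatrix} d & e & f \\ f & d & e \\ e & f & d \end{bmatrix},\quad H(x,y,u,v)=\begin{bmatrix} A & B \\ B^\ast & -A^\ast \end{bmatrix}.$$ The matrix $X_6(\alpha)$ is the dephased form of $H(x,y,u,v)$, i.e. the matrix obtained from $H(x,y,u,v)$ by multiplying rows and columns by unimodular numbers so that the first row and column consist of ones. *)

theory Defs
  imports
    Complex_Main
    "HOL-Computational_Algebra.Polynomial"
    "Jordan_Normal_Form.Schur_Decomposition"
begin

definition unit_circle :: "complex set" where
  "unit_circle = {z. cmod z = 1}"

definition phi :: "complex \<Rightarrow> complex \<Rightarrow> complex" where
  "phi x y = x + y + 1 / (x * y)"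

definition D_region :: "complex set" where
  "D_region = {phi x y | x y. x \<in> unit_circle \<and> y \<in> unit_circle}
            \<inter> {- phi x y | x y. x \<in> unit_circle \<and> y \<in> unit_circle}"

text \<open>Coefficients are listed from the constant term upwards:
  \<open>f_poly \<alpha>\<close> is \<open>x^3 - \<alpha> x^2 + cnj \<alpha> x - 1\<close>.\<close>
definition f_poly :: "complex \<Rightarrow> complex poly" where
  "f_poly \<alpha> = [:- 1, cnj \<alpha>, - \<alpha>, 1:]"

text \<open>The lists \<open>r\<close> and \<open>q\<close> enumerate the roots of \<open>f_poly \<alpha>\<close> and \<open>f_poly (- \<alpha>)\<close> with
  multiplicity, so \<open>x = y\<close> is possible when that value is a multiple root.\<close>
definition admissible ::
    "complex \<Rightarrow> complex \<Rightarrow> complex \<Rightarrow> complex \<Rightarrow> complex \<Rightarrow> bool" where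
  "admissible \<alpha> x y u v \<longleftrightarrow>
     (\<exists>r q. mset r = proots (f_poly \<alpha>) \<and> mset q = proots (f_poly (- \<alpha>)) \<and>
        (\<exists>i<length r. \<exists>j<length r. i \<noteq> j \<and> x = r ! i \<and> y = r ! j) \<and>
        (\<exists>k<length q. \<exists>l<length q. k \<noteq> l \<and> u = q ! k \<and> v = q ! l))"

definition circulant3 :: "complex \<Rightarrow> complex \<Rightarrow> complex \<Rightarrow> complex mat" where
  "circulant3 a b c = mat_of_rows_list 3 [[a, b, c], [c, a, b], [b, c, a]]"

definition H_mat :: "complex \<Rightarrow> complex \<Rightarrow> complex \<Rightarrow> complex \<Rightarrow> complex mat" where
  "H_mat x y u v =
     (let A = circulant3 1 (cnj x) (cnj x * cnj y);
          B = circulant3 1 (cnj u) (cnj u * cnj v)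
      in four_block_mat A B (mat_adjoint B) (- mat_adjoint A))"

definition fourier_mat :: "nat \<Rightarrow> complex mat" where
  "fourier_mat n = mat n n (\<lambda>(j, k).
     complex_of_real (1 / sqrt (real n)) *
     exp (2 * complex_of_real pi * \<i> * of_nat j * of_nat k / of_nat n))"

definition unitary_mat :: "nat \<Rightarrow> complex mat \<Rightarrow> bool" where
  "unitary_mat n U \<longleftrightarrow> U \<in> carrier_mat n n \<and>
     mat_adjoint U * U = 1\<^sub>m n \<and> U * mat_adjoint U = 1\<^sub>m n"

definition orthonormal_basis :: "nat \<Rightarrow> complex vec set \<Rightarrow> bool" where
  "orthonormal_basis n E \<longleftrightarrow>
     vectorspace.basis class_ring (module_vec TYPE(complex) n) E \<and>
     (\<forall>e\<in>E. \<forall>f\<in>E. e \<bullet>c f = (if e = f then 1 else 0))"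

definition mutually_unbiased_bases :: "nat \<Rightarrow> complex vec set list \<Rightarrow> bool" where
  "mutually_unbiased_bases n Bs \<longleftrightarrow>
     (\<forall>i<length Bs. orthonormal_basis n (Bs ! i)) \<and>
     (\<forall>i<length Bs. \<forall>j<length Bs. i \<noteq> j \<longrightarrow>
        (\<forall>e\<in>Bs ! i. \<forall>f\<in>Bs ! j. cmod (e \<bullet>c f) = 1 / sqrt (real n)))"

definition MUB_triplet :: "nat \<Rightarrow> complex mat \<Rightarrow> complex mat \<Rightarrow> complex mat \<Rightarrow> bool" where
  "MUB_triplet n M1 M2 M3 \<longleftrightarrow>
     unitary_mat n M1 \<and> unitary_mat n M2 \<and> unitary_mat n M3 \<and>
     mutually_unbiased_bases n (map (\<lambda>M. set (cols M)) [M1, M2, M3])"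

end

theory Submission
  imports Defs
begin

text \<open>The blocks \<open>A\<close> and \<open>B\<close> of \<open>H\<close> are circulant, hence conjugate under \<open>F\<^sub>3\<close> to diagonal
  matrices with entries \<open>a\<^sub>i\<close>, \<open>b\<^sub>i\<close>, and \<open>phi x y + phi u v = 0\<close> says precisely that
  \<open>\<bar>a\<^sub>i\<bar>\<^sup>2 + \<bar>b\<^sub>i\<bar>\<^sup>2 = 6\<close>. Likewise the blocks of \<open>Z\<^sub>1\<^sup>* Z\<^sub>2\<close> are conjugate under \<open>F\<^sub>3\<close>
  to \<open>(U + V) / 2\<close>, \<open>(U - V) Y / 2\<close>, \<open>X\<^sup>* (U - V) / 2\<close> and \<open>X\<^sup>* (U + V) Y / 2\<close>. So \<open>T = Z\<^sub>1\<^sup>* Z\<^sub>2\<close>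
  splits into three scalar problems, one for each \<open>i\<close>: split \<open>2 a\<^sub>i / \<surd>6\<close> as a sum \<open>u + v\<close> of
  unimodular numbers, which is possible as its modulus is at most 2, and absorb the phases
  into \<open>x\<close> and \<open>y\<close>. Unbiasedness is then the unimodularity of the entries of \<open>H\<close>.\<close>

section \<open>Adjoints and unitary matrices\<close>

lemma mat_adjoint_carrier [simp, intro]:
  "A \<in> carrier_mat n m \<Longrightarrow> mat_adjoint A \<in> carrier_mat m n"
  by (auto simp: mat_adjoint_def)

lemma dim_mat_adjoint [simp]:
  "dim_row (mat_adjoint A) = dim_col A" "dim_col (mat_adjoint A) = dim_row A"
  by (auto simp: mat_adjoint_def)

lemma index_mat_adjoint [simp]:
  fixes A :: "complex mat"
  shows "i < dim_col A \<Longrightarrow> j < dim_row A \<Longrightarrow> mat_adjoint A $$ (i, j) = cnj (A $$ (j, i))"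
  by (simp add: mat_adjoint_def mat_of_rows_index)

lemma mat_adjoint_mult:
  fixes A B :: "complex mat"
  assumes "A \<in> carrier_mat n m" "B \<in> carrier_mat m k"
  shows "mat_adjoint (A * B) = mat_adjoint B * mat_adjoint A"
  using assms by (intro eq_matI) (auto simp: scalar_prod_def mult.commute)

lemma mat_adjoint_mat_diag [simp]:
  "mat_adjoint (mat_diag n d) = mat_diag n (\<lambda>i. cnj (d i))"
  by (intro eq_matI) (auto simp: mat_diag_def)

lemma mat_adjoint_four_block_mat:
  fixes A B C D :: "complex mat"
  assumes "A \<in> carrier_mat n1 m1" "B \<in> carrier_mat n1 m2"
    "C \<in> carrier_mat n2 m1" "D \<in> carrier_mat n2 m2"
  shows "mat_adjoint (four_block_mat A B C D) =
    four_block_mat (mat_adjoint A) (mat_adjoint C) (mat_adjoint B) (mat_adjoint D)"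
  using assms by (intro eq_matI) auto

text \<open>Since \<open>\<bullet>c\<close> conjugates its second argument, the column of
  \<open>A\<close>, which is the one conjugated by the adjoint, stands on the right.\<close>

lemma cscalar_prod_col:
  fixes A B :: "complex mat"
  assumes "A \<in> carrier_mat n m" "B \<in> carrier_mat n k" "i < m" "j < k"
  shows "col B j \<bullet>c col A i = (mat_adjoint A * B) $$ (i, j)"
  using assms by (simp add: scalar_prod_def mult.commute)

lemma unitary_mat_diag:
  assumes "\<And>i. i < n \<Longrightarrow> cmod (d i) = 1"
  shows "unitary_mat n (mat_diag n d)"
proof -
  have "d i * cnj (d i) = 1" if "i < n" for i
    using assms[OF that] by (simp add: complex_norm_square[symmetric])
  then have "mat_diag n (\<lambda>i. d i * cnj (d i)) = 1\<^sub>m n"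
    by (intro eq_matI) (auto simp: mat_diag_def)
  then show ?thesis
    by (simp add: unitary_mat_def mult.commute)
qed

lemma diagonal_mat_diag: "diagonal_mat (mat_diag n d)"
  by (simp add: diagonal_mat_def mat_diag_def)

lemma unitary_matI:
  assumes "U \<in> carrier_mat n n" "mat_adjoint U * U = 1\<^sub>m n"
  shows "unitary_mat n U"
  using assms mat_mult_left_right_inverse[of "mat_adjoint U" n U] by (auto simp: unitary_mat_def)

section \<open>Unitary matrices and mutually unbiased bases\<close>

text \<open>The Gram matrix of the columns is \<open>mat_adjoint U * U = 1\<close>. So the columns
  are orthonormal, hence distinct; taking determinants makes them independent, and n independent
  vectors in dimension n form a basis.\<close>

lemma orthonormal_basis_cols_unitary:
  assumes "unitary_mat n U"
  shows "orthonormal_basis n (set (cols U))"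
proof -
  interpret vec_space "TYPE(complex)" n .
  have U: "U \<in> carrier_mat n n" and inv: "mat_adjoint U * U = 1\<^sub>m n"
    using assms by (auto simp: unitary_mat_def)
  have inner: "col U j \<bullet>c col U i = (if i = j then 1 else 0)" if "i < n" "j < n" for i j
    using cscalar_prod_col[OF U U that] that by (simp add: inv)
  have ne: "col U i \<noteq> col U j" if "i < n" "j < n" "i \<noteq> j" for i j
    using inner[of i j] inner[of i i] that by auto
  have dist: "distinct (cols U)"
    using U ne by (auto simp: distinct_conv_nth)
  have "det (mat_adjoint U) * det U = 1"
    using det_mult[of "mat_adjoint U" n U] U inv by simp
  then have "det (transpose_mat U) \<noteq> 0"
    using det_transpose[OF U] by auto
  then have "lin_indpt (set (cols U))"
    using det_not_0_imp_lin_indpt_rows[of "transpose_mat U"] U by simp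
  moreover have "card (set (cols U)) = n"
    using distinct_card[OF dist] U by simp
  ultimately have "basis (set (cols U))"
    using U cols_dim[of U] by (intro dim_li_is_basis) (auto simp: dim_is_n)
  moreover have "e \<bullet>c f = (if e = f then 1 else 0)"
    if ef: "e \<in> set (cols U)" "f \<in> set (cols U)" for e f
  proof -
    obtain i j where "i < n" "j < n" "e = col U i" "f = col U j"
      using ef U by (auto simp: in_set_conv_nth)
    then show ?thesis using inner ne by auto
  qed
  ultimately show ?thesis by (simp add: orthonormal_basis_def)
qed

lemma cmod_cscalar_prod_commute:
  fixes e f :: "complex vec"
  assumes "dim_vec e = dim_vec f"
  shows "cmod (e \<bullet>c f) = cmod (f \<bullet>c e)"
proof -
  have "e \<bullet>c f = cnj (f \<bullet>c e)"
    using assms by (simp add: scalar_prod_def mult.commute)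
  then show ?thesis by simp
qed

text \<open>Both orders of the inner product are recorded because
  \<open>mutually_unbiased_bases\<close> ranges over ordered pairs of bases.\<close>

lemma cmod_cscalar_prod_cols:
  assumes "A \<in> carrier_mat n n" "B \<in> carrier_mat n n"
    and "\<And>i j. i < n \<Longrightarrow> j < n \<Longrightarrow> cmod ((mat_adjoint A * B) $$ (i, j)) = \<gamma>"
    and "e \<in> set (cols A)" "f \<in> set (cols B)"
  shows "cmod (e \<bullet>c f) = \<gamma>" "cmod (f \<bullet>c e) = \<gamma>"
proof -
  obtain i j where ij: "i < n" "j < n" "e = col A i" "f = col B j"
    using assms(1,2,4,5) by (auto simp: in_set_conv_nth)
  then show "cmod (f \<bullet>c e) = \<gamma>"
    using assms cscalar_prod_col[OF assms(1,2)] by simp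
  then show "cmod (e \<bullet>c f) = \<gamma>"
    using ij assms(1,2) by (subst cmod_cscalar_prod_commute) auto
qed

lemma mat_adjoint_one [simp]: "mat_adjoint (1\<^sub>m n :: complex mat) = 1\<^sub>m n"
  by (intro eq_matI) auto

text \<open>Inner products with the standard basis are, up to conjugation, the entries of
  \<open>A\<close> and \<open>B\<close>; those between columns of \<open>A\<close> and of
  \<open>B\<close> are the entries of \<open>mat_adjoint A * B\<close>. Unbiasedness thus becomes a
  condition on entries.\<close>

lemma MUB_triplet_oneI:
  assumes A: "unitary_mat n A" and B: "unitary_mat n B"
    and entA: "\<And>i j. i < n \<Longrightarrow> j < n \<Longrightarrow> cmod (A $$ (i, j)) = 1 / sqrt n"
    and entB: "\<And>i j. i < n \<Longrightarrow> j < n \<Longrightarrow> cmod (B $$ (i, j)) = 1 / sqrt n"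
    and entAB: "\<And>i j. i < n \<Longrightarrow> j < n \<Longrightarrow> cmod ((mat_adjoint A * B) $$ (i, j)) = 1 / sqrt n"
  shows "MUB_triplet n (1\<^sub>m n) A B"
proof -
  have c: "A \<in> carrier_mat n n" "B \<in> carrier_mat n n" "1\<^sub>m n \<in> carrier_mat n n"
    using A B by (auto simp: unitary_mat_def)
  have one: "unitary_mat n (1\<^sub>m n)"
    by (simp add: unitary_mat_def)
  note 1 = cmod_cscalar_prod_cols[OF c(3) c(1), where \<gamma> = "1 / sqrt n"]
  note 2 = cmod_cscalar_prod_cols[OF c(3) c(2), where \<gamma> = "1 / sqrt n"]
  note 3 = cmod_cscalar_prod_cols[OF c(1) c(2), where \<gamma> = "1 / sqrt n"]
  show ?thesis
    unfolding MUB_triplet_def mutually_unbiased_bases_def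
    using one A B orthonormal_basis_cols_unitary 1 2 3 entA entB entAB c
    by (auto simp: less_Suc_eq numeral_3_eq_3)
qed

section \<open>Splitting a number into two unimodular summands\<close>

lemma norm_eq_1_iff_cnj: "cmod z = 1 \<longleftrightarrow> z * cnj z = 1"
  by (simp add: complex_norm_square[symmetric] flip: of_real_power)
     (metis of_real_eq_1_iff norm_ge_zero power2_eq_1_iff one_neq_neg_one abs_of_nonneg abs_neg_one)

text \<open>This is the problem for one index: \<open>p\<close> and \<open>q\<close> stand for
  \<open>2 a_i / sqrt 6\<close> and \<open>2 b_i / sqrt 6\<close>, and the four equations compare
  twice the eigenvalues of the four blocks of \<open>Z_1^* Z_2\<close> and of
  \<open>T\<close>.\<close>

lemma diag_pair_exists:
  fixes p q :: complex
  assumes "(cmod p)\<^sup>2 + (cmod q)\<^sup>2 = 4"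
  shows "\<exists>u v x y. cmod u = 1 \<and> cmod v = 1 \<and> cmod x = 1 \<and> cmod y = 1 \<and>
    u + v = p \<and> (u - v) * y = q \<and> cnj x * (u - v) = cnj q \<and> cnj x * (u + v) * y = - cnj p"
proof -
  \<comment> \<open>For unimodular \<open>u\<close>, \<open>v\<close> with sum \<open>p\<close>, the difference \<open>s = u - v\<close> is orthogonal to \<open>p\<close>
    and \<open>\<bar>p\<bar>\<^sup>2 + \<bar>s\<bar>\<^sup>2 = 4\<close>.\<close>
  obtain s where s: "cmod s = cmod q" "cnj p * s + p * cnj s = 0"
  \<comment> \<open>Every number is orthogonal to \<open>p = 0\<close>, so \<open>q\<close> itself
    serves; otherwise \<open>p\<close> is turned by a right angle and rescaled to modulus
    \<open>cmod q\<close>.\<close>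
  proof (cases "p = 0")
    case True
    then show ?thesis by (intro that[of q]) auto
  next
    case False
    show ?thesis
    proof (rule that[of "\<i> * p * complex_of_real (cmod q / cmod p)"])
      show "cmod (\<i> * p * complex_of_real (cmod q / cmod p)) = cmod q"
        using False by (simp add: norm_mult norm_divide)
    qed (simp add: algebra_simps)
  qed
  define u v where "u = (p + s) / 2" and "v = (p - s) / 2"
  have uv: "u + v = p" "u - v = s"
    by (auto simp: u_def v_def field_simps)
  have "p * cnj p + q * cnj q = 4"
    using assms by (metis complex_norm_square of_real_add of_real_numeral)
  moreover have "s * cnj s = q * cnj q"
    using s(1) by (metis complex_norm_square)
  ultimately have pq: "p * cnj p + s * cnj s = 4" by simp
  have "u * cnj u = (p * cnj p + s * cnj s + (cnj p * s + p * cnj s)) / 4"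
    "v * cnj v = (p * cnj p + s * cnj s - (cnj p * s + p * cnj s)) / 4"
    by (simp_all add: u_def v_def algebra_simps)
  then have "u * cnj u = 1" "v * cnj v = 1"
    unfolding pq s(2) by simp_all
  then have un: "cmod u = 1" "cmod v = 1"
    by (simp_all add: norm_eq_1_iff_cnj)
  show ?thesis
  proof (cases "q = 0")
    case True
    then have "s = 0" "cmod p = 2" using s(1) assms by (auto simp: power2_eq_iff_nonneg[of _ 2, simplified])
    then have "p \<noteq> 0" by auto
    \<comment> \<open>Here \<open>u = v\<close>, so the two equations in \<open>u - v\<close> are
      trivial: \<open>y = 1\<close> serves, and \<open>x = - p / cnj p\<close> is read off from the
      last equation.\<close>
    have "cmod (- p / cnj p) = 1" using \<open>p \<noteq> 0\<close> by (simp add: norm_divide)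
    moreover have "cnj (- p / cnj p) * (u + v) * 1 = - cnj p" using \<open>p \<noteq> 0\<close> uv by simp
    ultimately show ?thesis
      using un uv \<open>s = 0\<close> True by (intro exI[of _ u] exI[of _ v] exI[of _ "- p / cnj p"] exI[of _ 1]) auto
  next
    case False
    then have "s \<noteq> 0" using s(1) by auto
    \<comment> \<open>The choice \<open>x = q / cnj s\<close>, \<open>y = q / s\<close> solves the
      two middle equations. The last one becomes this identity, which follows by trading
      \<open>q * cnj q\<close> for \<open>s * cnj s\<close> and using orthogonality of
      \<open>p\<close> and \<open>s\<close>.\<close>
    have *: "cnj q * p * q / (s * s) = - cnj p"
    proof -
      have ps: "p * cnj s = - (cnj p * s)"
        using s(2) by (simp only: add_eq_0_iff)
      have "cnj q * p * q = p * cnj s * s"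
        using \<open>s * cnj s = q * cnj q\<close> by (simp add: mult_ac)
      also have "\<dots> = - cnj p * (s * s)"
        by (simp add: ps)
      finally show ?thesis using \<open>s \<noteq> 0\<close> by simp
    qed
    show ?thesis
      using un uv \<open>s \<noteq> 0\<close> False s(1) *
      by (intro exI[of _ u] exI[of _ v] exI[of _ "q / cnj s"] exI[of _ "q / s"])
         (auto simp: norm_divide)
  qed
qed

section \<open>Roots of \<open>f_poly\<close> and values of \<open>phi\<close>\<close>

text \<open>Names the root left over by an admissible pair; multisets keep this correct for repeated
  roots.\<close>

lemma two_elements_of_three:
  assumes "mset r = {#a, b, c#}" "i < length r" "j < length r" "i \<noteq> j"
  shows "\<exists>t. {#r ! i, r ! j, t#} = {#a, b, c#}"
proof -
  have "length r = 3" using assms(1) by (metis size_mset size_add_mset size_empty numeral_3_eq_3)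
  then obtain r0 r1 r2 where r: "r = [r0, r1, r2]"
    by (auto simp: numeral_3_eq_3 length_Suc_conv)
  have *: "i \<in> {0, 1, 2}" "j \<in> {0, 1, 2}" using assms(2,3) r by auto
  show ?thesis
    unfolding assms(1)[symmetric] r using * assms(4)
    by (auto simp: add_mset_commute)
qed

text \<open>With \<open>w = 1 / (s * t)\<close>, conjugation inverts the unimodular
  \<open>s\<close>, \<open>t\<close>, \<open>w\<close>, whose product is 1, so
  \<open>cnj \<beta>\<close> is their second elementary symmetric function and they are the roots of
  \<open>f_poly \<beta>\<close>. Any two of them determine the third as the inverse of their
  product, and the sum of all three is \<open>\<beta>\<close>.\<close>

lemma f_poly_root_pair:
  assumes "\<beta> = phi s t" "s \<in> unit_circle" "t \<in> unit_circle"
    and "mset r = proots (f_poly \<beta>)" "i < length r" "j < length r" "i \<noteq> j"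
  shows "cmod (r ! i) = 1 \<and> cmod (r ! j) = 1 \<and> phi (r ! i) (r ! j) = \<beta>"
proof -
  define w where "w = 1 / (s * t)"
  have nz: "s \<noteq> 0" "t \<noteq> 0" "cmod w = 1" and w: "s * t * w = 1"
    using assms(2,3) by (auto simp: unit_circle_def w_def norm_divide norm_mult)
  have "s * cnj s = 1" "t * cnj t = 1" "w * cnj w = 1"
    using assms(2,3) nz by (auto simp: unit_circle_def norm_eq_1_iff_cnj)
  moreover have "s * (t * w) = 1" "t * (s * w) = 1" "w * (s * t) = 1"
    using w by (simp_all add: mult_ac)
  ultimately have c: "cnj s = t * w" "cnj t = s * w" "cnj w = s * t"
    using inverse_unique by metis+
  have beta: "\<beta> = s + t + w" using assms(1) by (simp add: phi_def w_def)
  have cb: "cnj \<beta> = s * t + s * w + t * w"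
    by (simp add: beta c)
  have f: "f_poly \<beta> = [:-s, 1:] * ([:-t, 1:] * [:-w, 1:])"
    using w unfolding f_poly_def cb unfolding beta by (simp add: algebra_simps)
  have "proots (f_poly \<beta>) = {#s, t, w#}"
    unfolding f by (subst proots_mult, simp, simp, subst proots_mult, simp, simp, simp)
  then obtain z where z: "{#r ! i, r ! j, z#} = {#s, t, w#}"
    using two_elements_of_three assms(4-7) by metis
  have "set_mset {#r ! i, r ! j, z#} = {s, t, w}" unfolding z by simp
  then have n: "cmod (r ! i) = 1" "cmod (r ! j) = 1"
    using assms(2,3) nz by (auto simp: unit_circle_def)
  have "prod_mset {#r ! i, r ! j, z#} = 1" "sum_mset {#r ! i, r ! j, z#} = \<beta>"
    unfolding z using w by (simp_all add: beta mult.assoc add.assoc)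
  moreover have "r ! i \<noteq> 0" "r ! j \<noteq> 0"
    using n by auto
  ultimately have "z = 1 / (r ! i * r ! j)" "r ! i + r ! j + z = \<beta>"
    by (auto simp: field_simps)
  with n show ?thesis by (simp add: phi_def)
qed

section \<open>Fourier diagonalisation of circulant matrices of order 3\<close>

definition omega :: complex where
  "omega = cis (2 * pi / 3)"

lemma omega_rect: "omega = Complex (- 1 / 2) (sqrt 3 / 2)"
  by (simp add: omega_def cis.ctr cos_120' sin_120' mult.commute)

lemma norm_omega_power [simp]: "cmod (omega ^ k) = 1"
  by (simp add: omega_def norm_power)

lemma omega_square: "omega ^ 2 = - 1 - omega"
  by (simp add: omega_rect power2_eq_square complex_eq_iff)

lemma omega_cube [simp]: "omega ^ 3 = 1"
  by (simp add: omega_def Complex.DeMoivre)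

lemma cnj_omega: "cnj omega = - 1 - omega"
  by (simp add: omega_rect complex_eq_iff)

lemma fourier_mat_carrier [simp, intro]: "fourier_mat n \<in> carrier_mat n n"
  by (simp add: fourier_mat_def)

lemma dim_fourier_mat [simp]: "dim_row (fourier_mat n) = n" "dim_col (fourier_mat n) = n"
  by (simp_all add: fourier_mat_def)

lemma index_fourier_mat_3:
  assumes "i < 3" "j < 3"
  shows "fourier_mat 3 $$ (i, j) = complex_of_real (1 / sqrt 3) * omega ^ (i * j)"
  using assms
  by (simp add: fourier_mat_def omega_def cis_conv_exp flip: exp_of_nat_mult)
     (simp add: algebra_simps)

text \<open>A circulant given by its eigenvalues; only \<open>d 0\<close>, \<open>d 1\<close>,
  \<open>d 2\<close> matter. In this form the matrix operations act on \<open>d\<close>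
  pointwise.\<close>

definition spectral_circulant :: "(nat \<Rightarrow> complex) \<Rightarrow> complex mat" where
  "spectral_circulant d = mat_adjoint (fourier_mat 3) * mat_diag 3 d * fourier_mat 3"

lemma spectral_circulant_carrier [simp, intro]: "spectral_circulant d \<in> carrier_mat 3 3"
  by (auto simp: spectral_circulant_def intro!: mult_carrier_mat[of _ 3 3])

lemma dim_spectral_circulant [simp]: "dim_row (spectral_circulant d) = 3" "dim_col (spectral_circulant d) = 3"
  by (simp_all add: spectral_circulant_def)

lemma index_spectral_circulant:
  assumes "j < 3" "k < 3"
  shows "spectral_circulant d $$ (j, k) = (\<Sum>i<3. d i * cnj (omega ^ (i * j)) * omega ^ (i * k)) / 3"
proof -
  have "spectral_circulant d $$ (j, k) = (\<Sum>i<3. cnj (fourier_mat 3 $$ (i, j)) * d i * fourier_mat 3 $$ (i, k))"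
    using assms unfolding spectral_circulant_def
    by (subst mat_diag_mult_right[of _ 3]) (auto simp: scalar_prod_def lessThan_atLeast0)
  also have "\<dots> = (\<Sum>i<3. d i * cnj (omega ^ (i * j)) * omega ^ (i * k) / 3)"
    using assms
    by (intro sum.cong) (simp_all add: index_fourier_mat_3 field_simps flip: of_real_mult)
  finally show ?thesis by (simp add: sum_divide_distrib)
qed

lemma spectral_circulant_add: "spectral_circulant d + spectral_circulant e = spectral_circulant (\<lambda>i. d i + e i)"
  by (intro eq_matI) (auto simp: index_spectral_circulant sum.distrib algebra_simps add_divide_distrib)

lemma spectral_circulant_smult: "c \<cdot>\<^sub>m spectral_circulant d = spectral_circulant (\<lambda>i. c * d i)"
  by (intro eq_matI) (auto simp: index_spectral_circulant sum_distrib_left algebra_simps)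

lemma spectral_circulant_uminus: "- spectral_circulant d = spectral_circulant (\<lambda>i. - d i)"
  by (intro eq_matI) (auto simp: index_spectral_circulant sum_negf)

lemma mat_adjoint_spectral_circulant: "mat_adjoint (spectral_circulant d) = spectral_circulant (\<lambda>i. cnj (d i))"
  by (intro eq_matI) (auto simp: index_spectral_circulant algebra_simps)

lemma spectral_circulant_0: "spectral_circulant (\<lambda>i. 0) = 0\<^sub>m 3 3"
  by (intro eq_matI) (auto simp: index_spectral_circulant)

text \<open>Entry \<open>(j, k)\<close> on the right is the Fourier coefficient of the eigenvalues
  at \<open>k - j\<close> modulo 3; as \<open>1 + omega + omega ^ 2 = 0\<close>, only one of
  \<open>a\<close>, \<open>b\<close>, \<open>c\<close> survives.\<close>

lemma circulant3_eq_spectral_circulant: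
  "circulant3 a b c = spectral_circulant (\<lambda>i. a + b * cnj (omega ^ i) + c * omega ^ i)"
proof (intro eq_matI)
  let ?d = "\<lambda>i. a + b * cnj (omega ^ i) + c * omega ^ i"
  fix j k assume "j < dim_row (spectral_circulant ?d)" "k < dim_col (spectral_circulant ?d)"
  then have jk: "j < 3" "k < 3" by auto
  then have cases: "j = 0 \<or> j = 1 \<or> j = 2" "k = 0 \<or> k = 1 \<or> k = 2" by auto
  have w1: "omega * omega = - 1 - omega"
    using omega_square by (simp add: power2_eq_square)
  have w2: "omega * (omega * z) = - z - omega * z" for z
    unfolding mult.assoc[symmetric] w1 by (simp add: left_diff_distrib)
  \<comment> \<open>The exponent \<open>i * j\<close> with both factors below 3 exceeds 2 only as 4.
    \<open>w5\<close> is the conjugate of \<open>w4\<close> with \<open>cnj omega\<close> already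
    eliminated.\<close>
  have w4: "omega ^ 4 = omega"
    using omega_cube by (simp add: eval_nat_numeral)
  have w5: "(- 1 - omega) ^ 4 = - 1 - omega"
    using arg_cong[OF w4, of cnj] by (simp add: cnj_omega)
  have sum3: "(\<Sum>i<3. f i) = f 0 + f 1 + f 2" for f :: "nat \<Rightarrow> complex"
    by (simp add: eval_nat_numeral)
  from cases show "circulant3 a b c $$ (j, k) = spectral_circulant ?d $$ (j, k)"
    by (elim disjE)
       (simp_all add: circulant3_def mat_of_rows_list_def index_spectral_circulant sum3 cnj_omega w1 w2 w4 w5
          power2_eq_square algebra_simps)
qed (simp_all add: circulant3_def mat_of_rows_list_def)

text \<open>The identity is a circulant with all eigenvalues 1. Unfolded, this is the unitarity of
  \<open>F_3\<close>.\<close>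

lemma spectral_circulant_1: "spectral_circulant (\<lambda>i. 1) = 1\<^sub>m 3"
proof -
  have "circulant3 1 0 0 = 1\<^sub>m 3"
    by (intro eq_matI) (auto simp: less_Suc_eq numeral_3_eq_3 circulant3_def mat_of_rows_list_def)
  then show ?thesis by (simp add: circulant3_eq_spectral_circulant)
qed

section \<open>Eigenvalues of the two circulant blocks\<close>

text \<open>Expanding each squared modulus gives \<open>3 + 2 Re (w * phi x y)\<close> and the same
  with \<open>u\<close>, \<open>v\<close>; the real parts cancel by the hypothesis on
  \<open>phi\<close>.\<close>

lemma circulant_eigenvalue_norms:
  assumes "cmod x = 1" "cmod y = 1" "cmod u = 1" "cmod v = 1" "cmod w = 1" "w ^ 3 = 1"
    and "phi x y + phi u v = 0"
  shows "(cmod (1 + cnj x * cnj w + cnj x * cnj y * w))\<^sup>2 +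
    (cmod (1 + cnj u * cnj w + cnj u * cnj v * w))\<^sup>2 = 6"
proof -
  have key: "(1 + cnj x * cnj w + cnj x * cnj y * w) * cnj (1 + cnj x * cnj w + cnj x * cnj y * w)
      = 3 + w * phi x y + cnj (w * phi x y)"
    if xy: "cmod x = 1" "cmod y = 1" for x y
  proof -
    have c: "x * cnj x = 1" "y * cnj y = 1" "w * cnj w = 1"
      using xy assms(5) by (simp_all add: norm_eq_1_iff_cnj)
    have "1 / (x * y) = cnj x * cnj y"
      using inverse_unique[of "x * y" "cnj x * cnj y"] c
      by (metis inverse_eq_divide inverse_mult_distrib inverse_unique)
    then have p: "phi x y = x + y + cnj x * cnj y"
      by (simp add: phi_def)
    have ww: "w * w = cnj w"
      using assms(6) c(3) inverse_unique[of w] by (metis mult.assoc power3_eq_cube)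
    have WW: "cnj w * cnj w = w"
      using arg_cong[OF ww, of cnj] by simp
    \<comment> \<open>Conjugates become independent variables here, so that a polynomial identity
      remains, modulo the five listed relations.\<close>
    have "(1 + X * W + X * Y * w) * (1 + x * w + x * y * W)
        = 3 + w * (x + y + X * Y) + W * (X + Y + x * y)"
      if "x * X = 1" "y * Y = 1" "w * W = 1" "w * w = W" "W * W = w" for X Y W
    proof -
      have "(1 + X * W + X * Y * w) * (1 + x * w + x * y * W)
          = 1 + x * w + x * y * W + X * W + (x * X) * (w * W) + (x * X) * y * (W * W)
            + X * Y * w + (x * X) * Y * (w * w) + (x * X) * (y * Y) * (w * W)"
        by (simp add: algebra_simps)
      then show ?thesis
        unfolding that by (simp add: algebra_simps)
    qed
    from this[OF c ww WW] show ?thesis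
      by (simp add: p)
  qed
  have "complex_of_real ((cmod (1 + cnj x * cnj w + cnj x * cnj y * w))\<^sup>2 +
    (cmod (1 + cnj u * cnj w + cnj u * cnj v * w))\<^sup>2) = 6 + w * (phi x y + phi u v) + cnj (w * (phi x y + phi u v))"
    using key[OF assms(1,2)] key[OF assms(3,4)] 
    by (simp only: of_real_add complex_norm_square) (simp add: algebra_simps)
  also have "\<dots> = complex_of_real 6" using assms(7) by simp
  finally show ?thesis unfolding of_real_eq_iff .
qed

section \<open>Zauner's block matrices\<close>

lemma mat_adjoint_smult:
  fixes A :: "complex mat"
  shows "mat_adjoint (c \<cdot>\<^sub>m A) = cnj c \<cdot>\<^sub>m mat_adjoint A"
  by (intro eq_matI) auto

lemma smult_smult_mat: "c \<cdot>\<^sub>m (d \<cdot>\<^sub>m A) = (c * d :: 'a :: semigroup_mult) \<cdot>\<^sub>m A"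
  by (intro eq_matI) (auto simp: mult.assoc)

definition diag_fourier :: "(nat \<Rightarrow> complex) \<Rightarrow> complex mat" where
  "diag_fourier d = mat_diag 3 d * fourier_mat 3"

lemma diag_fourier_carrier [simp, intro]: "diag_fourier d \<in> carrier_mat 3 3"
  by (auto simp: diag_fourier_def intro!: mult_carrier_mat[of _ 3 3])

lemma dim_diag_fourier [simp]: "dim_row (diag_fourier d) = 3" "dim_col (diag_fourier d) = 3"
  using diag_fourier_carrier[of d] by (auto simp del: diag_fourier_carrier)

lemma index_diag_fourier:
  "i < 3 \<Longrightarrow> j < 3 \<Longrightarrow> diag_fourier d $$ (i, j) = d i * fourier_mat 3 $$ (i, j)"
  unfolding diag_fourier_def by (subst mat_diag_mult_left[of _ 3]) auto

lemma uminus_diag_fourier: "- diag_fourier d = diag_fourier (\<lambda>i. - d i)"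
  by (intro eq_matI) (auto simp: index_diag_fourier)

text \<open>The two diagonal factors meet in the middle and merge, leaving one diagonal matrix
  between the adjoint of \<open>F_3\<close> and \<open>F_3\<close>.\<close>

lemma adjoint_diag_fourier_mult:
  "mat_adjoint (diag_fourier d) * diag_fourier e = spectral_circulant (\<lambda>i. cnj (d i) * e i)"
proof -
  note c = fourier_mat_carrier[of 3] mat_adjoint_carrier[OF fourier_mat_carrier[of 3]] mat_diag_dim
  have "mat_adjoint (diag_fourier d) = mat_adjoint (fourier_mat 3) * mat_diag 3 (\<lambda>i. cnj (d i))"
    unfolding diag_fourier_def using c by (subst mat_adjoint_mult[of _ 3 3 _ 3]) auto
  then have "mat_adjoint (diag_fourier d) * diag_fourier e
      = mat_adjoint (fourier_mat 3) * (mat_diag 3 (\<lambda>i. cnj (d i)) * (mat_diag 3 e * fourier_mat 3))"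
    unfolding diag_fourier_def using c
    by (simp add: assoc_mult_mat[of _ 3 3 _ 3 _ 3] mult_carrier_mat[of _ 3 3 _ 3])
  also have "\<dots> = mat_adjoint (fourier_mat 3) * (mat_diag 3 (\<lambda>i. cnj (d i) * e i) * fourier_mat 3)"
    using c by (subst assoc_mult_mat[symmetric, of _ 3 3 _ 3 _ 3]) auto
  also have "\<dots> = spectral_circulant (\<lambda>i. cnj (d i) * e i)"
    unfolding spectral_circulant_def using c by (subst assoc_mult_mat[of _ 3 3 _ 3 _ 3]) auto
  finally show ?thesis .
qed

text \<open>One shape for both bases: \<open>u = v = 1\<close> gives \<open>Z_1\<close>, with
  \<open>y\<close> in the role of \<open>X\<close>.\<close>

definition zauner_mat :: "(nat \<Rightarrow> complex) \<Rightarrow> (nat \<Rightarrow> complex) \<Rightarrow> (nat \<Rightarrow> complex) \<Rightarrow> complex mat" where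
  "zauner_mat u v y = complex_of_real (1 / sqrt 2) \<cdot>\<^sub>m
    four_block_mat (mat_diag 3 u * fourier_mat 3) (mat_diag 3 u * mat_diag 3 y * fourier_mat 3)
      (mat_diag 3 v * fourier_mat 3) (- (mat_diag 3 v * mat_diag 3 y * fourier_mat 3))"

lemma zauner_mat_eq: "zauner_mat u v y = complex_of_real (1 / sqrt 2) \<cdot>\<^sub>m
    four_block_mat (diag_fourier u) (diag_fourier (\<lambda>i. u i * y i))
      (diag_fourier v) (diag_fourier (\<lambda>i. - (v i * y i)))"
  unfolding zauner_mat_def mat_diag_diag
  by (simp only: diag_fourier_def[symmetric] uminus_diag_fourier)

lemma zauner_mat_carrier [simp, intro]: "zauner_mat u v y \<in> carrier_mat 6 6"
  unfolding zauner_mat_eq by (rule carrier_matI) simp_all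

text \<open>The minus sign in the lower right blocks gives differences off the diagonal and cancels
  in the last block. Equal arguments yield unitarity; \<open>u1 = v1 = 1\<close> yields the blocks
  of \<open>T\<close>.\<close>

lemma zauner_mat_adjoint_mult:
  "mat_adjoint (zauner_mat u1 v1 y1) * zauner_mat u2 v2 y2 = (1 / 2) \<cdot>\<^sub>m four_block_mat
    (spectral_circulant (\<lambda>i. cnj (u1 i) * u2 i + cnj (v1 i) * v2 i))
    (spectral_circulant (\<lambda>i. (cnj (u1 i) * u2 i - cnj (v1 i) * v2 i) * y2 i))
    (spectral_circulant (\<lambda>i. cnj (y1 i) * (cnj (u1 i) * u2 i - cnj (v1 i) * v2 i)))
    (spectral_circulant (\<lambda>i. cnj (y1 i) * (cnj (u1 i) * u2 i + cnj (v1 i) * v2 i) * y2 i))"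
proof -
  let ?c = "complex_of_real (1 / sqrt 2)"
  let ?M1 = "four_block_mat (diag_fourier u1) (diag_fourier (\<lambda>i. u1 i * y1 i))
      (diag_fourier v1) (diag_fourier (\<lambda>i. - (v1 i * y1 i)))"
  let ?M2 = "four_block_mat (diag_fourier u2) (diag_fourier (\<lambda>i. u2 i * y2 i))
      (diag_fourier v2) (diag_fourier (\<lambda>i. - (v2 i * y2 i)))"
  have M: "?M1 \<in> carrier_mat 6 6" "?M2 \<in> carrier_mat 6 6" "mat_adjoint ?M1 \<in> carrier_mat 6 6"
    by (rule carrier_matI; simp)+
  have "?c * ?c = 1 / 2"
    by (simp flip: of_real_mult)
  then have "mat_adjoint (zauner_mat u1 v1 y1) * zauner_mat u2 v2 y2 = (1 / 2) \<cdot>\<^sub>m (mat_adjoint ?M1 * ?M2)"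
    unfolding zauner_mat_eq mat_adjoint_smult
    by (simp add: mult_smult_assoc_mat[OF M(3) smult_carrier_mat[OF M(2)]]
        mult_smult_distrib[OF M(3) M(2)] smult_smult_mat)
  also have "mat_adjoint ?M1 * ?M2 = four_block_mat
    (spectral_circulant (\<lambda>i. cnj (u1 i) * u2 i + cnj (v1 i) * v2 i))
    (spectral_circulant (\<lambda>i. (cnj (u1 i) * u2 i - cnj (v1 i) * v2 i) * y2 i))
    (spectral_circulant (\<lambda>i. cnj (y1 i) * (cnj (u1 i) * u2 i - cnj (v1 i) * v2 i)))
    (spectral_circulant (\<lambda>i. cnj (y1 i) * (cnj (u1 i) * u2 i + cnj (v1 i) * v2 i) * y2 i))"
    by (subst mat_adjoint_four_block_mat[of _ 3 3 _ 3 _ 3], simp_all)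
       (subst mult_four_block_mat[of _ 3 3 _ 3 _ 3 _ _ 3 _ 3],
        auto simp: adjoint_diag_fourier_mult spectral_circulant_add algebra_simps)
  finally show ?thesis .
qed

lemma unitary_zauner_mat:
  assumes "\<And>i. i < 3 \<Longrightarrow> cmod (u i) = 1" "\<And>i. i < 3 \<Longrightarrow> cmod (v i) = 1"
    "\<And>i. i < 3 \<Longrightarrow> cmod (y i) = 1"
  shows "unitary_mat 6 (zauner_mat u v y)"
proof (rule unitary_matI)
  have n: "cnj (u i) * u i = 1" "cnj (v i) * v i = 1" "cnj (y i) * y i = 1" if "i < 3" for i
    using assms[OF that] by (simp_all add: norm_eq_1_iff_cnj mult.commute)
  \<comment> \<open>Unimodularity is known only below 3, so the eigenvalue functions cannot be
    rewritten as a whole.\<close>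
  have cong: "spectral_circulant d = spectral_circulant e" if "\<And>i. i < 3 \<Longrightarrow> d i = e i" for d e
    using that by (intro eq_matI) (simp_all add: index_spectral_circulant)
  \<comment> \<open>The value 2 is kept as \<open>2 * 1\<close> so that
    \<open>spectral_circulant_smult\<close> can pull out the factor.\<close>
  have "mat_adjoint (zauner_mat u v y) * zauner_mat u v y = (1 / 2) \<cdot>\<^sub>m four_block_mat
    (spectral_circulant (\<lambda>i. 2 * 1)) (spectral_circulant (\<lambda>i. 0)) (spectral_circulant (\<lambda>i. 0)) (spectral_circulant (\<lambda>i. 2 * 1))"
    unfolding zauner_mat_adjoint_mult
    by (intro arg_cong[where f = "\<lambda>M. (1 / 2) \<cdot>\<^sub>m M"] cong_four_block_mat cong)
       (simp_all add: n mult.assoc)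
  also have "\<dots> = 1\<^sub>m 6"
    unfolding spectral_circulant_smult[symmetric] spectral_circulant_0 spectral_circulant_1 by (intro eq_matI) auto
  finally show "mat_adjoint (zauner_mat u v y) * zauner_mat u v y = 1\<^sub>m 6" .
qed simp

lemma cmod_index_zauner_mat:
  assumes "\<And>i. i < 3 \<Longrightarrow> cmod (u i) = 1" "\<And>i. i < 3 \<Longrightarrow> cmod (v i) = 1"
    "\<And>i. i < 3 \<Longrightarrow> cmod (y i) = 1" and "i < 6" "j < 6"
  shows "cmod (zauner_mat u v y $$ (i, j)) = 1 / sqrt 6"
proof -
  have "sqrt 2 * sqrt 3 = sqrt 6"
    by (simp flip: real_sqrt_mult)
  then show ?thesis
    using assms unfolding zauner_mat_eq
    by (auto simp: index_diag_fourier index_fourier_mat_3 norm_mult norm_divide field_simps)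
qed

section \<open>Factorisation of the 2-circulant matrix\<close>

lemma H_mat_spectral_circulant:
  fixes x y u v :: complex
  defines "a \<equiv> \<lambda>i. 1 + cnj x * cnj (omega ^ i) + cnj x * cnj y * omega ^ i"
    and "b \<equiv> \<lambda>i. 1 + cnj u * cnj (omega ^ i) + cnj u * cnj v * omega ^ i"
  shows "H_mat x y u v = four_block_mat (spectral_circulant a) (spectral_circulant b)
    (spectral_circulant (\<lambda>i. cnj (b i))) (spectral_circulant (\<lambda>i. - cnj (a i)))"
  by (simp add: H_mat_def circulant3_eq_spectral_circulant mat_adjoint_spectral_circulant spectral_circulant_uminus a_def b_def)

lemma cmod_index_circulant3:
  assumes "cmod a = 1" "cmod b = 1" "cmod c = 1" "i < 3" "j < 3"
  shows "cmod (circulant3 a b c $$ (i, j)) = 1"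
proof -
  have "i = 0 \<or> i = 1 \<or> i = 2" "j = 0 \<or> j = 1 \<or> j = 2"
    using assms(4,5) by auto
  then show ?thesis
    using assms(1-3) by (elim disjE) (simp_all add: circulant3_def mat_of_rows_list_def)
qed

lemma cmod_index_H_mat:
  assumes "cmod x = 1" "cmod y = 1" "cmod u = 1" "cmod v = 1" "i < 6" "j < 6"
  shows "cmod (H_mat x y u v $$ (i, j)) = 1"
proof -
  have [simp]: "dim_row (circulant3 a b c) = 3" "dim_col (circulant3 a b c) = 3" for a b c
    by (simp_all add: circulant3_eq_spectral_circulant)
  show ?thesis
    using assms by (simp add: H_mat_def Let_def cmod_index_circulant3 norm_mult)
qed

lemma H_mat_eq_zauner_quotient:
  assumes n: "cmod x = 1" "cmod y = 1" "cmod u = 1" "cmod v = 1"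
    and phi: "phi x y + phi u v = 0"
  obtains U V X Y where "\<And>i. cmod (U i) = 1" "\<And>i. cmod (V i) = 1"
    "\<And>i. cmod (X i) = 1" "\<And>i. cmod (Y i) = 1"
    "complex_of_real (1 / sqrt 6) \<cdot>\<^sub>m H_mat x y u v
      = mat_adjoint (zauner_mat (\<lambda>_. 1) (\<lambda>_. 1) X) * zauner_mat U V Y"
proof -
  define a where "a i = 1 + cnj x * cnj (omega ^ i) + cnj x * cnj y * omega ^ i" for i
  define b where "b i = 1 + cnj u * cnj (omega ^ i) + cnj u * cnj v * omega ^ i" for i
  \<comment> \<open>This scaling turns the sum 6 of squared moduli into the 4 of
    \<open>diag_pair_exists\<close>, and \<open>c / 2 = 1 / sqrt 6\<close>.\<close>
  define c where "c = complex_of_real (2 / sqrt 6)"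
  have c: "cnj c = c" "cmod c ^ 2 = 2 / 3"
    by (simp_all add: c_def norm_divide power_divide)
  have "(cmod (c * a i))\<^sup>2 + (cmod (c * b i))\<^sup>2 = 4" for i
  proof -
    have "(omega ^ i) ^ 3 = 1"
      by (metis omega_cube power_commutes power_mult mult.commute power_one)
    then have "(cmod (a i))\<^sup>2 + (cmod (b i))\<^sup>2 = 6"
      unfolding a_def b_def by (intro circulant_eigenvalue_norms n phi) simp_all
    then show ?thesis
      by (simp add: norm_mult power_mult_distrib c flip: distrib_left)
  qed
  \<comment> \<open>Every power of \<open>omega\<close> is a cube root of unity, so no bound on
    \<open>i\<close> is required and choice yields total functions.\<close>
  then have "\<forall>i. \<exists>u v x y. cmod u = 1 \<and> cmod v = 1 \<and> cmod x = 1 \<and> cmod y = 1 \<and>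
      u + v = c * a i \<and> (u - v) * y = c * b i \<and>
      cnj x * (u - v) = cnj (c * b i) \<and> cnj x * (u + v) * y = - cnj (c * a i)"
    using diag_pair_exists by blast
  then obtain U V X Y where uvxy: "\<And>i. cmod (U i) = 1" "\<And>i. cmod (V i) = 1"
      "\<And>i. cmod (X i) = 1" "\<And>i. cmod (Y i) = 1"
    and eqs: "\<And>i. U i + V i = c * a i" "\<And>i. (U i - V i) * Y i = c * b i"
      "\<And>i. cnj (X i) * (U i - V i) = cnj (c * b i)"
      "\<And>i. cnj (X i) * (U i + V i) * Y i = - cnj (c * a i)"
    by metis
  have "mat_adjoint (zauner_mat (\<lambda>_. 1) (\<lambda>_. 1) X) * zauner_mat U V Y
      = (1 / 2) \<cdot>\<^sub>m four_block_mat (spectral_circulant (\<lambda>i. c * a i)) (spectral_circulant (\<lambda>i. c * b i))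
          (spectral_circulant (\<lambda>i. c * cnj (b i))) (spectral_circulant (\<lambda>i. c * - cnj (a i)))"
    \<comment> \<open>The sum \<open>U i + V i\<close> is rewritten by the first equation, so the
      fourth one is first brought to the form it takes after that.\<close>
    unfolding zauner_mat_adjoint_mult by (simp add: eqs(1,2) eqs(3,4)[simplified eqs(1)] c)
  also have "\<dots> = (1 / 2) \<cdot>\<^sub>m (c \<cdot>\<^sub>m H_mat x y u v)"
    unfolding spectral_circulant_smult[symmetric] H_mat_spectral_circulant a_def b_def
    by (subst smult_four_block_mat[of _ 3 3 _ 3 _ 3, symmetric]) auto
  also have "\<dots> = complex_of_real (1 / sqrt 6) \<cdot>\<^sub>m H_mat x y u v"
    by (simp add: smult_smult_mat c_def)
  finally show ?thesis using that uvxy by metis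
qed

theorem theorem4p3:
  fixes \<alpha> x y u v :: complex
  assumes "\<alpha> \<in> D_region"
    and "admissible \<alpha> x y u v"
  shows "\<exists>U V X Y Z1 Z2.
    unitary_mat 3 U \<and> diagonal_mat U \<and>
    unitary_mat 3 V \<and> diagonal_mat V \<and>
    unitary_mat 3 X \<and> diagonal_mat X \<and>
    unitary_mat 3 Y \<and> diagonal_mat Y \<and>
    Z1 = complex_of_real (1 / sqrt 2) \<cdot>\<^sub>m
      four_block_mat (fourier_mat 3) (X * fourier_mat 3)
                     (fourier_mat 3) (- (X * fourier_mat 3)) \<and>
    Z2 = complex_of_real (1 / sqrt 2) \<cdot>\<^sub>m
      four_block_mat (U * fourier_mat 3) (U * Y * fourier_mat 3)
                     (V * fourier_mat 3) (- (V * Y * fourier_mat 3)) \<and>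
    (\<exists>W \<in> carrier_mat 6 6. inverts_mat W Z1 \<and> inverts_mat Z1 W \<and>
       complex_of_real (1 / sqrt 6) \<cdot>\<^sub>m H_mat x y u v = W * Z2) \<and>
    MUB_triplet 6 (1\<^sub>m 6) Z1 Z2"
proof -
  \<comment> \<open>Membership in both ranges exhibits \<open>\<alpha>\<close> and
    \<open>- \<alpha>\<close> as values of \<open>phi\<close>, which makes the roots of both cubics
    unimodular.\<close>
  obtain s t s' t' where st: "\<alpha> = phi s t" "s \<in> unit_circle" "t \<in> unit_circle"
    and st': "- \<alpha> = phi s' t'" "s' \<in> unit_circle" "t' \<in> unit_circle"
    using assms(1) unfolding D_region_def by force
  obtain r q i j k l where "mset r = proots (f_poly \<alpha>)" "mset q = proots (f_poly (- \<alpha>))"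
    "i < length r" "j < length r" "i \<noteq> j" "x = r ! i" "y = r ! j"
    "k < length q" "l < length q" "k \<noteq> l" "u = q ! k" "v = q ! l"
    using assms(2) unfolding admissible_def by blast
  then have xy: "cmod x = 1" "cmod y = 1" "phi x y = \<alpha>"
    and uv: "cmod u = 1" "cmod v = 1" "phi u v = - \<alpha>"
    using f_poly_root_pair[OF st] f_poly_root_pair[OF st'] by auto
  then have "phi x y + phi u v = 0" by simp
  then obtain U V X Y where d: "\<And>i. cmod (U i) = 1" "\<And>i. cmod (V i) = 1"
      "\<And>i. cmod (X i) = 1" "\<And>i. cmod (Y i) = 1"
    and T: "complex_of_real (1 / sqrt 6) \<cdot>\<^sub>m H_mat x y u v
      = mat_adjoint (zauner_mat (\<lambda>_. 1) (\<lambda>_. 1) X) * zauner_mat U V Y"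
    using H_mat_eq_zauner_quotient xy(1,2) uv(1,2) by metis
  define Z1 where "Z1 = zauner_mat (\<lambda>_. 1) (\<lambda>_. 1) X"
  define Z2 where "Z2 = zauner_mat U V Y"
  have Z1: "Z1 = complex_of_real (1 / sqrt 2) \<cdot>\<^sub>m
      four_block_mat (fourier_mat 3) (mat_diag 3 X * fourier_mat 3)
                     (fourier_mat 3) (- (mat_diag 3 X * fourier_mat 3))"
    unfolding Z1_def zauner_mat_def by (simp add: left_mult_one_mat[of _ 3 3])
  have un1: "unitary_mat 6 Z1" and un2: "unitary_mat 6 Z2"
    unfolding Z1_def Z2_def by (simp_all add: unitary_zauner_mat d)
  \<comment> \<open>By unitarity the adjoint is the inverse \<open>W\<close> asked for in the
    conclusion.\<close>
  then have W: "mat_adjoint Z1 \<in> carrier_mat 6 6" "inverts_mat (mat_adjoint Z1) Z1"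
      "inverts_mat Z1 (mat_adjoint Z1)"
    by (auto simp: unitary_mat_def inverts_mat_def)
  have "MUB_triplet 6 (1\<^sub>m 6) Z1 Z2"
  proof (rule MUB_triplet_oneI[OF un1 un2])
    fix i j :: nat assume ij: "i < 6" "j < 6"
    show "cmod (Z1 $$ (i, j)) = 1 / sqrt (real 6)" "cmod (Z2 $$ (i, j)) = 1 / sqrt (real 6)"
      unfolding Z1_def Z2_def using ij by (simp_all add: cmod_index_zauner_mat d)
    have "dim_row (H_mat x y u v) = 6" "dim_col (H_mat x y u v) = 6"
      by (simp_all add: H_mat_spectral_circulant)
    then show "cmod ((mat_adjoint Z1 * Z2) $$ (i, j)) = 1 / sqrt (real 6)"
      unfolding Z1_def Z2_def T[symmetric]
      using ij xy uv by (simp add: cmod_index_H_mat norm_divide)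
  qed
  moreover have "unitary_mat 3 (mat_diag 3 U)" "unitary_mat 3 (mat_diag 3 V)"
    "unitary_mat 3 (mat_diag 3 X)" "unitary_mat 3 (mat_diag 3 Y)"
    by (simp_all add: unitary_mat_diag d)
  moreover note diagonal_mat_diag Z1 Z2_def[unfolded zauner_mat_def] W T[folded Z1_def Z2_def]
  ultimately show ?thesis by metis
qed

end
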